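(* Let $I\subset\mathbb{R}$ be an interval with interior $I^{\circ}$, let $a,b\in I^{\circ}$ with $a<b$, and let $f:I\to\mathbb{R}$ be twice differentiable on $I^{\circ}$ with $f,f',f''\in L[a,b]$. Let $\alpha,\lambda\in[0,1]$ and let $p,q\ge 1$ be real with $\frac1p+\frac1q=1$. Suppose $|f''|^q$ is convex on $[a,b]$. Put $$E=(b-a)\left(\alpha-\tfrac12\right)f'\big((1-\alpha)b+\alpha a\big)-\frac{1}{b-a}\int_a^b f(x)\,dx+(1-\lambda)f\big((1-\alpha)b+\alpha a\big)+\lambda\big(\alpha f(a)+(1-\alpha)f(b)\big),$$ $$P=\left[\varepsilon_1|f''(b)|^q+\beta(1-\alpha;q+1,2)|f''(a)|^q\right]^{\frac1q},\qquad Q=\left[\beta(\alpha;q+1,2)|f''(b)|^q+\varepsilon_2|f''(a)|^q\right]^{\frac1q},$$ where $\varepsilon_1=\frac{(1-\alpha)^{q+2}}{q+2}$ and $\varepsilon_2=\frac{\alpha^{q+2}}{q+2}$. Put $$\varphi_1=\frac{(2\alpha\lambda)^{p+1}+\big(1-\alpha(1+2\lambda)\big)^{p+1}}{p+1},\qquad \varphi_2=\frac{(2\alpha\lambda)^{p+1}-\big(\alpha(1+2\lambda)-1\big)^{p+1}}{p+1},$$ $$\psi_1=\frac{\big(2\lambda(1-\alpha)\big)^{p+1}+\big(\alpha-2\lambda(1-\alpha)\big)^{p+1}}{p+1},\qquad \psi_2=\frac{\big(2\lambda(1-\alpha)\big)^{p+1}-\big(2\lambda(1-\alpha)-\alpha\big)^{p+1}}{p+1}$$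 (each used below only when the bases of its powers are nonnegative). Then: (i) if $2\alpha\lambda\le 1-\alpha\le 1-2\lambda(1-\alpha)$, then $|E|\le\frac{(b-a)^2}{2}\left\{\varphi_1^{1/p}P+\psi_1^{1/p}Q\right\}$; (ii) if $1-\alpha\ge\max\{2\alpha\lambda,\,1-2\lambda(1-\alpha)\}$, then $|E|\le\frac{(b-a)^2}{2}\left\{\varphi_1^{1/p}P+\psi_2^{1/p}Q\right\}$; (iii) if $1-\alpha\le\min\{2\alpha\lambda,\,1-2\lambda(1-\alpha)\}$, then $|E|\le\frac{(b-a)^2}{2}\left\{\varphi_2^{1/p}P+\psi_1^{1/p}Q\right\}$; (iv) if $1-2\lambda(1-\alpha)\le 1-\alpha\le 2\alpha\lambda$, then $|E|\le\frac{(b-a)^2}{2}\left\{\varphi_2^{1/p}P+\psi_2^{1/p}Q\right\}$.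
   Context: $L[a,b]$ denotes the Lebesgue integrable real-valued functions on $[a,b]$. $\beta$ is the (unnormalized) incomplete Beta function $\beta(x;u,v)=\int_0^x t^{u-1}(1-t)^{v-1}\,dt$ for $x\in[0,1]$, $u,v>0$. *)

theory Defs
  imports "HOL-Analysis.Analysis"
begin

definition incomplete_Beta :: "real \<Rightarrow> real \<Rightarrow> real \<Rightarrow> real" where
  "incomplete_Beta x u v = (LINT t:{0..x}|lebesgue. t powr (u - 1) * (1 - t) powr (v - 1))"

definition E_term :: "(real \<Rightarrow> real) \<Rightarrow> real \<Rightarrow> real \<Rightarrow> real \<Rightarrow> real \<Rightarrow> real" where
  "E_term f a b \<alpha> \<mu> =
     (b - a) * (\<alpha> - 1/2) * deriv f ((1 - \<alpha>) * b + \<alpha> * a)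
     - 1 / (b - a) * (LINT x:{a..b}|lebesgue. f x)
     + (1 - \<mu>) * f ((1 - \<alpha>) * b + \<alpha> * a)
     + \<mu> * (\<alpha> * f a + (1 - \<alpha>) * f b)"

definition P_term :: "(real \<Rightarrow> real) \<Rightarrow> real \<Rightarrow> real \<Rightarrow> real \<Rightarrow> real \<Rightarrow> real" where
  "P_term f a b \<alpha> q =
     ((1 - \<alpha>) powr (q + 2) / (q + 2) * \<bar>deriv (deriv f) b\<bar> powr q
      + incomplete_Beta (1 - \<alpha>) (q + 1) 2 * \<bar>deriv (deriv f) a\<bar> powr q) powr (1 / q)"

definition Q_term :: "(real \<Rightarrow> real) \<Rightarrow> real \<Rightarrow> real \<Rightarrow> real \<Rightarrow> real \<Rightarrow> real" where
  "Q_term f a b \<alpha> q =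
     (incomplete_Beta \<alpha> (q + 1) 2 * \<bar>deriv (deriv f) b\<bar> powr q
      + \<alpha> powr (q + 2) / (q + 2) * \<bar>deriv (deriv f) a\<bar> powr q) powr (1 / q)"

text \<open>
  The following four expressions are meant only for parameters for which all
  bases of powers are nonnegative. There \<^const>\<open>powr\<close> is the usual real power,
  with \<open>0 powr r = 0\<close>. Here \<open>\<mu>\<close> stands for the second weight parameter, usually
  written lambda. On their respective ranges, \<open>phi1\<close> and \<open>phi2\<close> are the closed
  forms of the integral of \<open>\<bar>2 * \<alpha> * \<mu> - t\<bar> powr p\<close> over \<open>0 \<le> t \<le> 1 - \<alpha>\<close>, and \<open>psi1\<close>
  and \<open>psi2\<close> those of \<open>\<bar>2 * \<mu> * (1 - \<alpha>) - t\<bar> powr p\<close> over \<open>0 \<le> t \<le> \<alpha>\<close>.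
\<close>

definition phi1 :: "real \<Rightarrow> real \<Rightarrow> real \<Rightarrow> real" where
  "phi1 \<alpha> \<mu> p =
     ((2 * \<alpha> * \<mu>) powr (p + 1) + (1 - \<alpha> * (1 + 2 * \<mu>)) powr (p + 1)) / (p + 1)"

definition phi2 :: "real \<Rightarrow> real \<Rightarrow> real \<Rightarrow> real" where
  "phi2 \<alpha> \<mu> p =
     ((2 * \<alpha> * \<mu>) powr (p + 1) - (\<alpha> * (1 + 2 * \<mu>) - 1) powr (p + 1)) / (p + 1)"

definition psi1 :: "real \<Rightarrow> real \<Rightarrow> real \<Rightarrow> real" where
  "psi1 \<alpha> \<mu> p =
     ((2 * \<mu> * (1 - \<alpha>)) powr (p + 1) + (\<alpha> - 2 * \<mu> * (1 - \<alpha>)) powr (p + 1)) / (p + 1)"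

definition psi2 :: "real \<Rightarrow> real \<Rightarrow> real \<Rightarrow> real" where
  "psi2 \<alpha> \<mu> p =
     ((2 * \<mu> * (1 - \<alpha>)) powr (p + 1) - (2 * \<mu> * (1 - \<alpha>) - \<alpha>) powr (p + 1)) / (p + 1)"

end

theory Submission
  imports Defs
begin

text \<open>With \<open>h = b - a\<close>, \<open>k = 2 * \<alpha> * \<mu>\<close> and \<open>l = 2 * \<mu> * (1 - \<alpha>)\<close>, integrating by parts twice shows that
  \<open>E\<close> is \<open>h\<^sup>2 / 2\<close> times the sum of the integral of \<open>t * (k - t) * f''(a + t * h)\<close> over \<open>0 \<le> t \<le> 1 - \<alpha>\<close>
  and that of \<open>t * (l - t) * f''(b - t * h)\<close> over \<open>0 \<le> t \<le> \<alpha>\<close>. Each is estimated by Hoelder's inequality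
  with the factors \<open>\<bar>k - t\<bar>\<close> (respectively \<open>\<bar>l - t\<bar>\<close>) and \<open>t * \<bar>f''\<bar>\<close>, using the convexity of
  \<open>\<bar>f''\<bar> powr q\<close> in the second one; the four cases only differ in the signs of
  \<open>k - (1 - \<alpha>)\<close> and \<open>l - \<alpha>\<close>.\<close>

section \<open>Hoelder's inequality for the gauge integral\<close>

text \<open>Young's inequality is applied pointwise to \<open>u\<close> and \<open>v\<close> divided
  by their norms; integrating turns its right-hand side into at most
  \<open>1 / p + 1 / q = 1\<close>.\<close>

lemma Holder_has_integral:
  fixes u v :: "'n::euclidean_space \<Rightarrow> real"
  assumes pq: "p > 1" "q > 1" "1 / p + 1 / q = 1"
    and nonneg: "\<And>x. x \<in> S \<Longrightarrow> 0 \<le> u x" "\<And>x. x \<in> S \<Longrightarrow> 0 \<le> v x"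
    and U: "((\<lambda>x. u x powr p) has_integral U) S"
    and V: "((\<lambda>x. v x powr q) has_integral V) S"
    and Z: "((\<lambda>x. u x * v x) has_integral Z) S"
  shows "Z \<le> U powr (1 / p) * V powr (1 / q)"
proof -
  have U0: "0 \<le> U" and V0: "0 \<le> V"
    using has_integral_nonneg[OF U] has_integral_nonneg[OF V] by auto
  \<comment> \<open>Enlarging \<open>U\<close> and \<open>V\<close> by \<open>e\<close> makes both
    normalising constants positive, so the division is legitimate even if one of the integrals
    vanishes.\<close>
  have bound: "Z \<le> (U + e) powr (1 / p) * (V + e) powr (1 / q)" if e: "e > 0" for e
  proof -
    define A where "A = (U + e) powr (1 / p)"
    define B where "B = (V + e) powr (1 / q)"
    have A: "A > 0" "A powr p = U + e" and B: "B > 0" "B powr q = V + e"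
      using U0 V0 e pq by (auto simp: A_def B_def powr_powr)
    have le: "u x * v x \<le> A * B * (u x powr p / (p * (U + e)) + v x powr q / (q * (V + e)))"
      if "x \<in> S" for x
    proof -
      have "u x / A * (v x / B) \<le> (u x / A) powr p / p + (v x / B) powr q / q"
        using Youngs_inequality[of p q "u x / A" "v x / B"] pq nonneg[OF that] A B by simp
      also have "\<dots> = u x powr p / (p * (U + e)) + v x powr q / (q * (V + e))"
        using nonneg[OF that] A B by (simp add: powr_divide mult.commute)
      finally have "(u x / A * (v x / B)) * (A * B)
          \<le> (u x powr p / (p * (U + e)) + v x powr q / (q * (V + e))) * (A * B)"
        using A B by (intro mult_right_mono) auto
      then show ?thesis using A B by (simp add: mult.commute)
    qed
    have "((\<lambda>x. A * B * (u x powr p / (p * (U + e)) + v x powr q / (q * (V + e))))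
        has_integral (A * B * (U / (p * (U + e)) + V / (q * (V + e))))) S"
      by (intro has_integral_mult_right has_integral_add has_integral_divide U V)
    from has_integral_le[OF Z this le]
    have "Z \<le> A * B * (U / (p * (U + e)) + V / (q * (V + e)))" by simp
    also have "\<dots> \<le> A * B * 1"
    proof (intro mult_left_mono)
      have "U / (p * (U + e)) + V / (q * (V + e)) \<le> 1 / p + 1 / q"
        using U0 V0 e pq by (intro add_mono) (simp_all add: divide_simps)
      then show "U / (p * (U + e)) + V / (q * (V + e)) \<le> 1" using pq by simp
    qed (use A B in simp)
    finally show ?thesis by (simp add: A_def B_def)
  qed
  \<comment> \<open>Letting \<open>e\<close> tend to 0 is harmless when \<open>U\<close> or
    \<open>V\<close> is 0, because \<open>powr\<close> with a positive exponent is continuous from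
    the right at base 0.\<close>
  have "((\<lambda>e. (U + e) powr (1 / p) * (V + e) powr (1 / q)) \<longlongrightarrow>
      (U + 0) powr (1 / p) * (V + 0) powr (1 / q)) (at_right 0)"
    using U0 V0 pq
    by (intro tendsto_intros tendsto_powr') (auto intro!: eventually_at_rightI[of 0 1])
  moreover have "\<forall>\<^sub>F e in at_right 0. Z \<le> (U + e) powr (1 / p) * (V + e) powr (1 / q)"
    using bound by (auto intro!: eventually_at_rightI[of 0 1])
  ultimately show ?thesis
    using tendsto_lowerbound by fastforce
qed

lemma has_integral_powr_diff_left:
  fixes c k p :: real
  assumes "p > 0" "0 \<le> c" "c \<le> k"
  shows "((\<lambda>t. \<bar>k - t\<bar> powr p) has_integral
           (k powr (p + 1) - (k - c) powr (p + 1)) / (p + 1)) {0..c}"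
proof -
  \<comment> \<open>If \<open>c = k\<close>, the base \<open>k - t\<close> vanishes at the right
    endpoint, where the power rule does not apply. The interior form of the fundamental theorem asks
    only for continuity there.\<close>
  have "((\<lambda>t. \<bar>k - t\<bar> powr p) has_integral
      - ((k - c) powr (p + 1) / (p + 1)) - - ((k - 0) powr (p + 1) / (p + 1))) {0..c}"
  proof (rule fundamental_theorem_of_calculus_interior)
    show "continuous_on {0..c} (\<lambda>t. - ((k - t) powr (p + 1) / (p + 1)))"
      using assms by (intro continuous_intros continuous_on_powr') auto
    show "((\<lambda>t. - ((k - t) powr (p + 1) / (p + 1))) has_vector_derivative \<bar>k - t\<bar> powr p) (at t)"
      if "t \<in> {0<..<c}" for t
    proof -
      have "((\<lambda>t. (k - t) powr (p + 1)) has_real_derivative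
          (p + 1) * (k - t) powr (p + 1 - of_nat 1) * (- 1)) (at t)"
        using that assms by (intro DERIV_fun_powr) (auto intro!: derivative_eq_intros)
      from DERIV_minus[OF DERIV_cdivide[OF this, of "p + 1"]] show ?thesis
        using that assms by (simp add: has_real_derivative_iff_has_vector_derivative)
    qed
  qed (use assms in auto)
  then show ?thesis by (simp add: diff_divide_distrib)
qed

lemma has_integral_powr_diff_right:
  fixes c k p :: real
  assumes "p > 0" "k \<le> c"
  shows "((\<lambda>t. \<bar>k - t\<bar> powr p) has_integral (c - k) powr (p + 1) / (p + 1)) {k..c}"
proof -
  have "((\<lambda>t. \<bar>k - t\<bar> powr p) has_integral
      (c - k) powr (p + 1) / (p + 1) - (k - k) powr (p + 1) / (p + 1)) {k..c}"
  proof (rule fundamental_theorem_of_calculus_interior)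
    show "continuous_on {k..c} (\<lambda>t. (t - k) powr (p + 1) / (p + 1))"
      using assms by (intro continuous_intros continuous_on_powr') auto
    show "((\<lambda>t. (t - k) powr (p + 1) / (p + 1)) has_vector_derivative \<bar>k - t\<bar> powr p) (at t)"
      if "t \<in> {k<..<c}" for t
    proof -
      have "((\<lambda>t. (t - k) powr (p + 1)) has_real_derivative
          (p + 1) * (t - k) powr (p + 1 - of_nat 1) * 1) (at t)"
        using that assms by (intro DERIV_fun_powr) (auto intro!: derivative_eq_intros)
      from DERIV_cdivide[OF this, of "p + 1"] show ?thesis
        using that assms by (simp add: has_real_derivative_iff_has_vector_derivative)
    qed
  qed (use assms in auto)
  then show ?thesis using assms by simp
qed

lemma has_integral_powr_diff_inside:
  fixes c k p :: real
  assumes "p > 0" "0 \<le> k" "k \<le> c"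
  shows "((\<lambda>t. \<bar>k - t\<bar> powr p) has_integral
           (k powr (p + 1) + (c - k) powr (p + 1)) / (p + 1)) {0..c}"
  using has_integral_combine[OF assms(2,3) has_integral_powr_diff_left[OF assms(1,2) order_refl]
      has_integral_powr_diff_right[OF assms(1,3)]] assms(1)
  by (simp add: add_divide_distrib)

section \<open>Double integration by parts against a quadratic kernel\<close>

text \<open>The sign of \<open>h\<close> is left open so that the same formula serves for the
  segment leaving \<open>a\<close> to the right and for the one leaving \<open>b\<close> to the
  left. The fundamental theorem for the gauge integral yields integrability of the kernel together
  with its value.\<close>

lemma has_integral_quadratic_kernel:
  fixes F f f' f'' :: "real \<Rightarrow> real" and S :: "real set" and x h c k :: real
  defines "m \<equiv> x + c * h"
  assumes "0 \<le> c" "h \<noteq> 0" and S: "\<And>t. t \<in> {0..c} \<Longrightarrow> x + t * h \<in> S"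
    and F: "\<And>y. y \<in> S \<Longrightarrow> (F has_real_derivative f y) (at y within S)"
    and f: "\<And>y. y \<in> S \<Longrightarrow> (f has_real_derivative f' y) (at y within S)"
    and f': "\<And>y. y \<in> S \<Longrightarrow> (f' has_real_derivative f'' y) (at y within S)"
  shows "((\<lambda>t. t * (k - t) * f'' (x + t * h)) has_integral
           (c * (k - c) * f' m / h - (k - 2 * c) * f m / h^2 + k * f x / h^2
            - 2 * (F m - F x) / h^3)) {0..c}"
proof -
  \<comment> \<open>The coefficients \<open>t * (k - t)\<close>, \<open>k - 2 * t\<close> and
    \<open>- 2\<close> are successive derivatives, taken with alternating signs; each passage to a
    primitive along \<open>x + t * h\<close> costs a factor \<open>1 / h\<close>.\<close>
  define G where "G t = t * (k - t) * f' (x + t * h) / h - (k - 2 * t) * f (x + t * h) / h^2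
    - 2 * F (x + t * h) / h^3" for t
  have "((\<lambda>t. t * (k - t) * f'' (x + t * h)) has_integral (G c - G 0)) {0..c}"
  proof (rule fundamental_theorem_of_calculus[OF \<open>0 \<le> c\<close>])
    fix t assume t: "t \<in> {0..c}"
    have chain: "((\<lambda>t. g (x + t * h)) has_real_derivative g' * h) (at t within {0..c})"
      if "(g has_real_derivative g') (at (x + t * h) within S)" for g g'
    proof -
      have "(g has_real_derivative g') (at (x + t * h) within (\<lambda>t. x + t * h) ` {0..c})"
        using that S by (rule_tac has_field_derivative_subset) auto
      moreover have "((\<lambda>t. x + t * h) has_real_derivative h) (at t within {0..c})"
        by (auto intro!: derivative_eq_intros)
      ultimately show ?thesis
        using DERIV_image_chain[of g g' "\<lambda>t. x + t * h" t "{0..c}" h] by (simp add: o_def)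
    qed
    note [derivative_intros] = chain[OF F[OF S[OF t]]] chain[OF f[OF S[OF t]]] chain[OF f'[OF S[OF t]]]
    have "(G has_real_derivative t * (k - t) * f'' (x + t * h)) (at t within {0..c})"
      unfolding G_def using \<open>h \<noteq> 0\<close>
      by (auto intro!: derivative_eq_intros simp: field_simps power2_eq_square power3_eq_cube)
    then show "(G has_vector_derivative t * (k - t) * f'' (x + t * h)) (at t within {0..c})"
      by (simp add: has_real_derivative_iff_has_vector_derivative)
  qed
  moreover have "G c - G 0 = c * (k - c) * f' m / h - (k - 2 * c) * f m / h^2 + k * f x / h^2
            - 2 * (F m - F x) / h^3"
    by (simp add: G_def m_def diff_divide_distrib algebra_simps)
  ultimately show ?thesis by simp
qed

section \<open>Estimating one kernel integral\<close>

text \<open>On \<open>{0..x}\<close> the factor \<open>(1 - t) powr (2 - 1)\<close> is just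
  \<open>1 - t\<close>. Since \<open>u > 1\<close>, the integrand is continuous up to 0, so Lebesgue
  and gauge integral agree.\<close>

lemma incomplete_Beta_has_integral:
  assumes "u > 1" "0 \<le> x" "x \<le> 1"
  shows "((\<lambda>t. t powr (u - 1) * (1 - t)) has_integral incomplete_Beta x u 2) {0..x}"
proof -
  have "continuous_on {0..x} (\<lambda>t. t powr (u - 1) * (1 - t))"
    using assms by (intro continuous_intros continuous_on_powr') auto
  then have "(\<lambda>t. t powr (u - 1) * (1 - t)) absolutely_integrable_on {0..x}"
    by (rule absolutely_integrable_continuous_real)
  moreover have "incomplete_Beta x u 2 = (LINT t:{0..x}|lebesgue. t powr (u - 1) * (1 - t))"
    unfolding incomplete_Beta_def using assms by (intro set_lebesgue_integral_cong) auto
  ultimately show ?thesis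
    by (simp add: has_integral_set_lebesgue)
qed

text \<open>Applying the convexity bound pointwise before integrating replaces the merely integrable
  \<open>g\<close> by a continuous majorant, so no integrability of \<open>\<bar>g\<bar> powr q\<close> has to be established.\<close>

lemma quadratic_kernel_bound:
  fixes g :: "real \<Rightarrow> real" and A B c k p q J T :: real
  assumes pq: "p > 1" "q > 1" "1 / p + 1 / q = 1" and c: "0 \<le> c" "c \<le> 1" and AB: "0 \<le> A" "0 \<le> B"
    and g: "\<And>t. t \<in> {0..c} \<Longrightarrow> \<bar>g t\<bar> powr q \<le> t * B + (1 - t) * A"
    and J: "((\<lambda>t. \<bar>k - t\<bar> powr p) has_integral J) {0..c}"
    and T: "((\<lambda>t. t * (k - t) * g t) has_integral T) {0..c}"
  shows "\<bar>T\<bar> \<le> J powr (1 / p) *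
           (c powr (q + 2) / (q + 2) * B + incomplete_Beta c (q + 1) 2 * A) powr (1 / q)"
proof -
  define w where "w t = (t * B + (1 - t) * A) powr (1 / q)" for t
  have nn: "0 \<le> t * B + (1 - t) * A" if "t \<in> {0..c}" for t
    using that c AB by auto
  have w: "\<bar>g t\<bar> \<le> w t" if "t \<in> {0..c}" for t
  proof -
    have "\<bar>g t\<bar> = (\<bar>g t\<bar> powr q) powr (1 / q)"
      using pq by (simp add: powr_powr)
    also have "\<dots> \<le> w t"
      unfolding w_def using g[OF that] pq by (intro powr_mono2) auto
    finally show ?thesis .
  qed
  have "continuous_on {0..c} (\<lambda>t. \<bar>k - t\<bar> * (t * w t))"
    unfolding w_def using nn pq by (intro continuous_intros continuous_on_powr') auto
  then obtain Z where Z: "((\<lambda>t. \<bar>k - t\<bar> * (t * w t)) has_integral Z) {0..c}"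
    using integrable_continuous_real by blast
  \<comment> \<open>The factor \<open>t\<close> is grouped with the majorant \<open>w\<close> of
    \<open>\<bar>g\<bar>\<close>, leaving exactly the function integrated by \<open>J\<close> as the
    other Hoelder factor.\<close>
  have "norm (integral {0..c} (\<lambda>t. t * (k - t) * g t)) \<le> integral {0..c} (\<lambda>t. \<bar>k - t\<bar> * (t * w t))"
  proof (rule integral_norm_bound_integral)
    show "norm (t * (k - t) * g t) \<le> \<bar>k - t\<bar> * (t * w t)" if "t \<in> {0..c}" for t
      using mult_left_mono[OF w[OF that], of "\<bar>k - t\<bar> * t"] that by (simp add: abs_mult mult_ac)
  qed (use T Z in blast)+
  then have TZ: "\<bar>T\<bar> \<le> Z"
    using integral_unique[OF T] integral_unique[OF Z] by simp
  have "((\<lambda>t. t powr (q + 1) * B + t powr (q + 1 - 1) * (1 - t) * A) has_integral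
      (c powr (q + 1 + 1) / (q + 1 + 1) * B + incomplete_Beta c (q + 1) 2 * A)) {0..c}"
    using pq c
    by (intro has_integral_add has_integral_mult_left incomplete_Beta_has_integral
        has_integral_powr_from_0) auto
  \<comment> \<open>The power \<open>q\<close> undoes the root in \<open>w\<close>. The exponent is
    kept as \<open>q + 1 - 1\<close> to match the Beta integrand with first parameter
    \<open>q + 1\<close>.\<close>
  moreover have "t powr (q + 1) * B + t powr (q + 1 - 1) * (1 - t) * A = (t * w t) powr q"
    if "t \<in> {0..c}" for t
  proof -
    have "(t * w t) powr q = t powr q * (t * B + (1 - t) * A)"
      using that nn[OF that] pq by (simp add: w_def powr_mult powr_powr)
    also have "\<dots> = t powr (q + 1) * B + t powr (q + 1 - 1) * (1 - t) * A"
      using that by (simp add: powr_add algebra_simps)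
    finally show ?thesis by simp
  qed
  ultimately have "((\<lambda>t. (t * w t) powr q) has_integral
      (c powr (q + 1 + 1) / (q + 1 + 1) * B + incomplete_Beta c (q + 1) 2 * A)) {0..c}"
    by (rule has_integral_eq[rotated])
  then have "Z \<le> J powr (1 / p) *
      (c powr (q + 1 + 1) / (q + 1 + 1) * B + incomplete_Beta c (q + 1) 2 * A) powr (1 / q)"
    by (intro Holder_has_integral[OF pq _ _ J _ Z]) (auto simp: w_def)
  with TZ show ?thesis by (simp add: add.assoc)
qed

section \<open>The identity for \<open>E_term\<close> and the common bound\<close>

text \<open>Keeping \<open>J\<close> and \<open>K\<close> abstract treats all four cases at once;
  only their closed forms depend on the case.\<close>

lemma E_term_bound:
  fixes f :: "real \<Rightarrow> real" and a b \<alpha> \<mu> p q J K :: real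
  assumes ab: "a < b" and S: "open S" "{a..b} \<subseteq> S"
    and f: "f differentiable_on S" and f': "deriv f differentiable_on S"
    and \<alpha>: "0 \<le> \<alpha>" "\<alpha> \<le> 1" and pq: "p > 1" "q > 1" "1 / p + 1 / q = 1"
    and conv: "convex_on {a..b} (\<lambda>x. \<bar>deriv (deriv f) x\<bar> powr q)"
    and J: "((\<lambda>t. \<bar>2 * \<alpha> * \<mu> - t\<bar> powr p) has_integral J) {0..1 - \<alpha>}"
    and K: "((\<lambda>t. \<bar>2 * \<mu> * (1 - \<alpha>) - t\<bar> powr p) has_integral K) {0..\<alpha>}"
  shows "\<bar>E_term f a b \<alpha> \<mu>\<bar> \<le> (b - a)\<^sup>2 / 2 *
           (J powr (1 / p) * P_term f a b \<alpha> q + K powr (1 / p) * Q_term f a b \<alpha> q)"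
proof -
  define h where "h = b - a"
  define F where "F x = integral {a..x} f" for x
  define m where "m = (1 - \<alpha>) * b + \<alpha> * a"
  have h: "h > 0" using ab by (simp add: h_def)
  have Df: "(f has_real_derivative deriv f x) (at x within {a..b})"
    and Df': "(deriv f has_real_derivative deriv (deriv f) x) (at x within {a..b})"
    if "x \<in> {a..b}" for x
    using f f' S that
    by (simp_all add: differentiable_on_eq_differentiable_at subset_iff
        DERIV_deriv_iff_real_differentiable has_field_derivative_at_within)
  have cont: "continuous_on {a..b} f"
    using Df DERIV_continuous_on by blast
  have DF: "(F has_real_derivative f x) (at x within {a..b})" if "x \<in> {a..b}" for x
    unfolding F_def by (rule integral_has_real_derivative[OF cont that])
  have right: "a + t * h = (1 - t) * a + t * b" and left: "b - t * h = (1 - t) * b + t * a" for t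
    by (simp_all add: h_def algebra_simps)
  have m: "a + (1 - \<alpha>) * h = m" "b + \<alpha> * (- h) = m"
    by (simp_all add: m_def h_def algebra_simps)
  have mem: "(1 - t) * x + t * y \<in> {a..b}" if "t \<in> {0..1}" "x \<in> {a..b}" "y \<in> {a..b}" for x y t
    using convexD_alt[of "{a..b}" x y t] that by simp
  have bound: "\<bar>deriv (deriv f) ((1 - t) * x + t * y)\<bar> powr q
      \<le> t * \<bar>deriv (deriv f) y\<bar> powr q + (1 - t) * \<bar>deriv (deriv f) x\<bar> powr q"
    if "t \<in> {0..1}" "x \<in> {a..b}" "y \<in> {a..b}" for x y t
    using convex_onD[OF conv, of t x y] that by simp
  let ?k = "2 * \<alpha> * \<mu>" and ?l = "2 * \<mu> * (1 - \<alpha>)"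
  define T where "T = (1 - \<alpha>) * (?k - (1 - \<alpha>)) * deriv f m / h
    - (?k - 2 * (1 - \<alpha>)) * f m / h^2 + ?k * f a / h^2 - 2 * (F m - F a) / h^3"
  \<comment> \<open>This is the expression of \<open>T\<close> started at \<open>b\<close> with step
    \<open>- h\<close>, with \<open>\<alpha>\<close> and \<open>1 - \<alpha>\<close> interchanged.
    Both segments end at \<open>m\<close>.\<close>
  define R where "R = \<alpha> * (?l - \<alpha>) * deriv f m / (- h)
    - (?l - 2 * \<alpha>) * f m / (- h)^2 + ?l * f b / (- h)^2 - 2 * (F m - F b) / (- h)^3"
  have T: "((\<lambda>t. t * (?k - t) * deriv (deriv f) (a + t * h)) has_integral T) {0..1 - \<alpha>}"
    unfolding T_def m(1)[symmetric]
    by (rule has_integral_quadratic_kernel[OF _ _ _ DF Df Df'])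
      (use h \<alpha> ab mem[of _ a b] in \<open>auto simp: right\<close>)
  have R: "((\<lambda>t. t * (?l - t) * deriv (deriv f) (b + t * (- h))) has_integral R) {0..\<alpha>}"
    unfolding R_def m(2)[symmetric]
    by (rule has_integral_quadratic_kernel[OF _ _ _ DF Df Df'])
      (use h \<alpha> ab mem[of _ b a] in \<open>auto simp: left\<close>)
  have Tb: "\<bar>T\<bar> \<le> J powr (1 / p) * P_term f a b \<alpha> q"
    unfolding P_term_def
    by (rule quadratic_kernel_bound[OF pq _ _ _ _ _ J T])
      (use \<alpha> ab bound[of _ a b] in \<open>auto simp: right\<close>)
  have Rb: "\<bar>R\<bar> \<le> K powr (1 / p) * Q_term f a b \<alpha> q"
    unfolding Q_term_def add.commute[of "incomplete_Beta \<alpha> (q + 1) 2 * _"]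
    by (rule quadratic_kernel_bound[OF pq _ _ _ _ _ K R])
      (use \<alpha> ab bound[of _ b a] in \<open>auto simp: left\<close>)
  have "(LINT x:{a..b}|lebesgue. f x) = F b"
    unfolding F_def using cont
    by (intro set_lebesgue_integral_eq_integral absolutely_integrable_continuous_real)
  moreover have "F a = 0" by (simp add: F_def)
  \<comment> \<open>The \<open>F m\<close> terms cancel. The weights of \<open>f m\<close> combine
    through \<open>?k + ?l = 2 * \<mu>\<close>, and those of \<open>deriv f m\<close> through
    \<open>(1 - \<alpha>) * ?k = \<alpha> * ?l\<close>, which leaves
    \<open>(2 * \<alpha> - 1) / h\<close> in \<open>T + R\<close>.\<close>
  ultimately have "E_term f a b \<alpha> \<mu> = h\<^sup>2 / 2 * (T + R)"
    unfolding E_term_def T_def R_def m_def[symmetric] h_def[symmetric] using h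
    by (simp add: field_simps power2_eq_square power3_eq_cube)
  then have "\<bar>E_term f a b \<alpha> \<mu>\<bar> = h\<^sup>2 / 2 * \<bar>T + R\<bar>"
    by (simp only: abs_mult) simp
  also have "\<dots> \<le> h\<^sup>2 / 2 *
      (J powr (1 / p) * P_term f a b \<alpha> q + K powr (1 / p) * Q_term f a b \<alpha> q)"
    using Tb Rb by (intro mult_left_mono) auto
  finally show ?thesis by (simp add: h_def)
qed

section \<open>The four cases\<close>

theorem theorem5:
  fixes I :: "real set" and f :: "real \<Rightarrow> real" and a b \<alpha> \<mu> p q :: real
  assumes "is_interval I"
    and "a \<in> interior I" and "b \<in> interior I" and "a < b"
    and "f differentiable_on interior I"
    and "deriv f differentiable_on interior I"
    and "f absolutely_integrable_on {a..b}"
    and "deriv f absolutely_integrable_on {a..b}"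
    and "deriv (deriv f) absolutely_integrable_on {a..b}"
    and "\<alpha> \<in> {0..1}" and "\<mu> \<in> {0..1}"
    and "p \<ge> 1" and "q \<ge> 1" and "1 / p + 1 / q = 1"
    and "convex_on {a..b} (\<lambda>x. \<bar>deriv (deriv f) x\<bar> powr q)"
  shows
    "(2 * \<alpha> * \<mu> \<le> 1 - \<alpha> \<and> 1 - \<alpha> \<le> 1 - 2 * \<mu> * (1 - \<alpha>) \<longrightarrow>
        \<bar>E_term f a b \<alpha> \<mu>\<bar> \<le> (b - a)\<^sup>2 / 2 *
          (phi1 \<alpha> \<mu> p powr (1 / p) * P_term f a b \<alpha> q
           + psi1 \<alpha> \<mu> p powr (1 / p) * Q_term f a b \<alpha> q))
   \<and> (1 - \<alpha> \<ge> max (2 * \<alpha> * \<mu>) (1 - 2 * \<mu> * (1 - \<alpha>)) \<longrightarrow>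
        \<bar>E_term f a b \<alpha> \<mu>\<bar> \<le> (b - a)\<^sup>2 / 2 *
          (phi1 \<alpha> \<mu> p powr (1 / p) * P_term f a b \<alpha> q
           + psi2 \<alpha> \<mu> p powr (1 / p) * Q_term f a b \<alpha> q))
   \<and> (1 - \<alpha> \<le> min (2 * \<alpha> * \<mu>) (1 - 2 * \<mu> * (1 - \<alpha>)) \<longrightarrow>
        \<bar>E_term f a b \<alpha> \<mu>\<bar> \<le> (b - a)\<^sup>2 / 2 *
          (phi2 \<alpha> \<mu> p powr (1 / p) * P_term f a b \<alpha> q
           + psi1 \<alpha> \<mu> p powr (1 / p) * Q_term f a b \<alpha> q))
   \<and> (1 - 2 * \<mu> * (1 - \<alpha>) \<le> 1 - \<alpha> \<and> 1 - \<alpha> \<le> 2 * \<alpha> * \<mu> \<longrightarrow>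
        \<bar>E_term f a b \<alpha> \<mu>\<bar> \<le> (b - a)\<^sup>2 / 2 *
          (phi2 \<alpha> \<mu> p powr (1 / p) * P_term f a b \<alpha> q
           + psi2 \<alpha> \<mu> p powr (1 / p) * Q_term f a b \<alpha> q))"
proof -
  \<comment> \<open>Two positive reciprocals with sum 1 are both below 1, which excludes the
    endpoint exponents.\<close>
  have "1 / p > 0" "1 / q > 0" using assms(12,13) by auto
  then have "1 / p < 1" "1 / q < 1" using assms(14) by linarith+
  then have pq: "p > 1" "q > 1" using assms(12,13) by auto
  have "closed_segment a b \<subseteq> interior I"
    using assms(1-3) by (intro closed_segment_subset convex_interior is_interval_convex)
  then have "{a..b} \<subseteq> interior I"
    using assms(4) by (simp add: closed_segment_eq_real_ivl)
  note bound = E_term_bound[OF assms(4) open_interior this assms(5,6) _ _ pq assms(14,15)]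
  have nonneg: "0 \<le> 2 * \<alpha> * \<mu>" "0 \<le> 2 * \<mu> * (1 - \<alpha>)" and \<alpha>: "0 \<le> \<alpha>" "\<alpha> \<le> 1"
    using assms(10,11) by auto
  have phi1: "((\<lambda>t. \<bar>2 * \<alpha> * \<mu> - t\<bar> powr p) has_integral phi1 \<alpha> \<mu> p) {0..1 - \<alpha>}"
    if "2 * \<alpha> * \<mu> \<le> 1 - \<alpha>"
  proof -
    have eq: "1 - \<alpha> * (1 + 2 * \<mu>) = 1 - \<alpha> - 2 * \<alpha> * \<mu>" by (simp add: algebra_simps)
    show ?thesis
      unfolding phi1_def eq using has_integral_powr_diff_inside[OF _ nonneg(1) that, of p] pq by simp
  qed
  have phi2: "((\<lambda>t. \<bar>2 * \<alpha> * \<mu> - t\<bar> powr p) has_integral phi2 \<alpha> \<mu> p) {0..1 - \<alpha>}"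
    if "1 - \<alpha> \<le> 2 * \<alpha> * \<mu>"
  proof -
    have eq: "\<alpha> * (1 + 2 * \<mu>) - 1 = 2 * \<alpha> * \<mu> - (1 - \<alpha>)" by (simp add: algebra_simps)
    show ?thesis
      unfolding phi2_def eq using has_integral_powr_diff_left[OF _ _ that, of p] \<alpha> pq by simp
  qed
  \<comment> \<open>The condition says that \<open>2 * \<mu> * (1 - \<alpha>)\<close> is at most
    \<open>\<alpha>\<close>, so the zero of the linear factor lies in
    \<open>{0..\<alpha>}\<close>.\<close>
  have psi1: "((\<lambda>t. \<bar>2 * \<mu> * (1 - \<alpha>) - t\<bar> powr p) has_integral psi1 \<alpha> \<mu> p) {0..\<alpha>}"
    if "1 - \<alpha> \<le> 1 - 2 * \<mu> * (1 - \<alpha>)"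
    unfolding psi1_def using has_integral_powr_diff_inside[OF _ nonneg(2), of p \<alpha>] that pq by simp
  have psi2: "((\<lambda>t. \<bar>2 * \<mu> * (1 - \<alpha>) - t\<bar> powr p) has_integral psi2 \<alpha> \<mu> p) {0..\<alpha>}"
    if "1 - 2 * \<mu> * (1 - \<alpha>) \<le> 1 - \<alpha>"
    unfolding psi2_def using has_integral_powr_diff_left[of p \<alpha> "2 * \<mu> * (1 - \<alpha>)"] that \<alpha> pq by simp
  \<comment> \<open>Each case fixes the position of both zeros, and so selects one
    \<open>phi\<close> for \<open>J\<close> and one \<open>psi\<close> for \<open>K\<close>.\<close>
  show ?thesis
    by (intro conjI impI bound \<alpha> phi1 phi2 psi1 psi2) simp_all
qed

end
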